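(* Let $X$ be a real $n \times p$ matrix with $p < n$ and $\mathrm{rank}(X) = p$, let $\beta \in \mathbb{R}^p$, $\sigma^2 > 0$, and let $Y$ be a random vector in $\mathbb{R}^n$ with $Y - X\beta \sim N(0, \sigma^2 I_n)$. Let $\hat\beta = (X^T X)^{-1} X^T Y$ and let $R = Y - X\hat\beta$ be the vector of residuals. Let $v\in\mathbb{R}^p$ be defined in any one of the following ways: (i) $v = \left( T - X^{(p)} \right)^{-1} R^{(p)}$, where $T$ is the upper triangular $p\times p$ matrix in the Householder QR factorization of $X$ using the standard sign choices (see context); (ii) $v = \left( C - X^{(p)} \right)^{-1} R^{(p)}$, where $C$ is a non-singular $p \times p$ matrix such that $XC^{-1}$ has orthonormal columns and $C - X^{(p)}$ is non-singular; (iii) more generally, $v = S R^{(p)}$, where $C$ is a non-singular $p\times p$ matrix such that $XC^{-1}$ has orthonormal columns, and $S$ is a $p\times p$ matrix having the same rank as $C - X^{(p)}$ for which there is an $n\times(n-p)$ matrix $M$ whose columns are an orthonormal basis of $\mathrm{col}(X)^\perp$ with $M^T x = x_{(p)} + X_{(p)} S x^{(p)}$ for all $x \in \mathrm{col}(X)^\perp$. Then $W = R_{(p)} + X_{(p)} v$ satisfies $W \sim N(0, \sigma^2 I_{n-p})$ and $W^T W = R^T R$.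
   Context: For a matrix or column vector $A$ with $n$ rows, $A^{(k)}$ denotes the first $k$ rows of $A$ and $A_{(k)}$ the last $n-k$ rows. $\mathrm{col}(X)$ is the column space of $X$, and $\perp$ denotes orthogonal complement in $\mathbb{R}^n$. $e_k$ is the $k$-th standard basis vector of $\mathbb{R}^n$, and $x_k$ is the $k$-th column of $X$. $N(m,\Sigma)$ is the multivariate normal distribution with mean $m$ and covariance $\Sigma$. Householder algorithm. Put $G_0 = I_n$. For $k = 0, 1, \dots, p-1$, given $G_k$, choose a sign $d_{k+1} \in \{1,-1\}$ and define $$v_{k+1} = \begin{bmatrix} 0 \\ (G_k x_{k+1})_{(k)} \end{bmatrix} + d_{k+1} \left\| (G_k x_{k+1})_{(k)} \right\| e_{k+1} \in \mathbb{R}^n$$ (where the $0$ block has $k$ entries), $H_{k+1} = I_n - \frac{2}{\|v_{k+1}\|^2} v_{k+1} v_{k+1}^T$ if $v_{k+1} \neq 0$ and $H_{k+1} = I_n$ if $v_{k+1} = 0$, and $G_{k+1} = H_{k+1} G_k$. At the end $G_p X = \begin{bmatrix} T \\ 0 \end{bmatrix}$ with $T$ a $p\times p$ upper triangular matrix; this is the $T$ of the Householder QR factorization. The standard sign choice at step $k+1$ is $d_{k+1} = \mathrm{sgn}\big((G_k x_{k+1})_{k+1}\big)$, the sign of the $(k+1)$-st component of $G_k x_{k+1}$; if that component is $0$, $d_{k+1}$ may be either of $1,-1$. With these sign choices $T - X^{(p)}$ is non-singular. (The vectors $v_{k+1}$ of the algorithm are unrelated to the vector $v$ of the claim.) *)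

theory Defs
  imports "HOL-Probability.Probability"
begin

text \<open>
  An \<open>n \<times> p\<close> matrix with \<open>p < n\<close> is a \<open>real^'p^('p + 'q)\<close>: the row indices \<open>Inl j\<close> are the first
  \<open>p\<close> rows, in the order of \<^typ>\<open>'p\<close>, and the row indices \<open>Inr j\<close> are the last \<open>n - p\<close> rows.
  So \<open>n = CARD('p + 'q)\<close>, \<open>p = CARD('p)\<close>, \<open>n - p = CARD('q)\<close>, and \<open>p < n\<close> holds because
  types are nonempty. The two functions below take both vectors and matrices.
\<close>

definition top_rows :: "'a^('p::finite + 'q::finite) \<Rightarrow> 'a^'p"
  where "top_rows A = (\<chi> i. A $ Inl i)"

definition bottom_rows :: "'a^('p::finite + 'q::finite) \<Rightarrow> 'a^'q"
  where "bottom_rows A = (\<chi> i. A $ Inr i)"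

definition orthonormal_columns :: "real^'m^'n \<Rightarrow> bool"
  where "orthonormal_columns A \<longleftrightarrow>
    (\<forall>i j. column i A \<bullet> column j A = (if i = j then 1 else 0))"

definition col_space :: "real^'m^'n \<Rightarrow> (real^'n) set"
  where "col_space A = span (columns A)"


subsection \<open>Householder algorithm\<close>

text \<open>Indices are counted from 0: \<open>nth_index k\<close> is the \<open>(k+1)\<close>-st element of \<^typ>\<open>'p\<close>, and
  \<open>d k\<close> is the sign used in the \<open>(k+1)\<close>-st step.\<close>

definition nth_index :: "nat \<Rightarrow> 'p::{finite,linorder}"
  where "nth_index k = sorted_list_of_set UNIV ! k"

text \<open>For \<open>k \<le> p\<close>, replaces the first \<open>k\<close> entries by 0; \<open>card {..<j}\<close> is the position of \<open>j\<close>
  counted from 0. The norm of the result is the norm of the block of the last \<open>n - k\<close> entries.\<close>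

definition zero_first :: "nat \<Rightarrow> real^('p::{finite,linorder} + 'q::finite) \<Rightarrow> real^('p + 'q)"
  where "zero_first k x =
    (\<chi> i. case i of Inl j \<Rightarrow> if card {..<j} < k then 0 else x $ i | Inr _ \<Rightarrow> x $ i)"

definition householder_vector ::
    "nat \<Rightarrow> real \<Rightarrow> real^('p::{finite,linorder} + 'q::finite) \<Rightarrow> real^('p + 'q)"
  where "householder_vector k s x =
    zero_first k x + (s * norm (zero_first k x)) *\<^sub>R axis (Inl (nth_index k)) 1"

definition householder_reflection :: "real^'n \<Rightarrow> real^'n^'n"
  where "householder_reflection v =
    (if v = 0 then mat 1 else mat 1 - (2 / (norm v)\<^sup>2) *\<^sub>R (\<chi> i j. v $ i * v $ j))"

primrec householder_G ::
    "real^'p::{finite,linorder}^('p + 'q::finite) \<Rightarrow> (nat \<Rightarrow> real) \<Rightarrow> nat \<Rightarrow> real^('p + 'q)^('p + 'q)"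
  where
    "householder_G X d 0 = mat 1"
  | "householder_G X d (Suc k) =
      householder_reflection
        (householder_vector k (d k) (householder_G X d k *v column (nth_index k) X))
      ** householder_G X d k"

definition standard_signs ::
    "real^'p::{finite,linorder}^('p + 'q::finite) \<Rightarrow> (nat \<Rightarrow> real) \<Rightarrow> bool"
  where "standard_signs X d \<longleftrightarrow>
    (\<forall>k < CARD('p). d k \<in> {1, -1} \<and>
      (let c = (householder_G X d k *v column (nth_index k) X) $ Inl (nth_index k)
       in c \<noteq> 0 \<longrightarrow> d k = sgn c))"

definition householder_T ::
    "real^'p::{finite,linorder}^('p + 'q::finite) \<Rightarrow> (nat \<Rightarrow> real) \<Rightarrow> real^'p::{finite,linorder}^'p::{finite,linorder}"
  where "householder_T X d = top_rows (householder_G X d CARD('p) ** X)"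


subsection \<open>Linear regression and the multivariate normal distribution\<close>

definition ols_estimate :: "real^'p^'n \<Rightarrow> real^'n \<Rightarrow> real^'p"
  where "ols_estimate X y = matrix_inv (transpose X ** X) *v (transpose X *v y)"

definition residual :: "real^'p^'n \<Rightarrow> real^'n \<Rightarrow> real^'n"
  where "residual X y = y - X *v ols_estimate X y"

text \<open>The Lebesgue density of \<open>N(m, \<Sigma>)\<close>, for positive definite \<open>\<Sigma>\<close>.\<close>

definition mvn_density :: "real^'n \<Rightarrow> real^'n^'n \<Rightarrow> real^'n \<Rightarrow> real"
  where "mvn_density m \<Sigma> x =
    exp (- ((x - m) \<bullet> (matrix_inv \<Sigma> *v (x - m))) / 2) / sqrt ((2 * pi) ^ CARD('n) * det \<Sigma>)"

end

theory Submission
  imports Defs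
begin

text \<open>
  In each of the three cases \<open>W = N\<^sup>T R\<close> for a matrix \<open>N\<close> whose columns are an orthonormal basis of
  \<open>col(X)\<^sup>\<bottom>\<close>. As \<open>R\<close> lies in \<open>col(X)\<^sup>\<bottom>\<close>, this gives \<open>W\<^sup>T W = R\<^sup>T R\<close>, and as \<open>N\<^sup>T X = 0\<close>, it gives
  \<open>W = N\<^sup>T (Y - X \<beta>)\<close>. With \<open>Q = X C\<^sup>-\<^sup>1\<close>, the transpose of \<open>[Q N]\<close> is an orthogonal \<open>n \<times> n\<close> matrix, so \<open>W\<close>
  consists of the last \<open>n - p\<close> components of a rotated \<open>N(0, \<sigma>\<^sup>2 I)\<close> vector.

  Case (iii) provides \<open>N\<close>. In case (ii), put \<open>Z = C - X\<^sup>(\<^sup>p\<^sup>)\<close>; then \<open>N u = (b, u) - Q b\<close> with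
  \<open>b = Z\<^sup>-\<^sup>T X\<^sub>(\<^sub>p\<^sub>)\<^sup>T u\<close> works. Case (i) is case (ii) with \<open>C = T\<close>. If \<open>(T - X\<^sup>(\<^sup>p\<^sup>)) z = 0\<close> there, then \<open>y = X z\<close> is
  a fixed vector of \<open>G\<^sub>p = H\<^sub>p \<dots> H\<^sub>1\<close> with \<open>y\<^sub>(\<^sub>p\<^sub>) = 0\<close>. The standard signs make the \<open>k\<close>-th entry of \<open>v\<^sub>k\<close>
  nonzero, and the first \<open>k - 1\<close> entries of \<open>v\<^sub>k\<close> vanish; hence \<open>y\<close> is orthogonal to all \<open>v\<^sub>k\<close>, and \<open>y = 0\<close>.
\<close>

subsection \<open>Marginals and orthogonal invariance\<close>

lemma prod_Basis_vec: "(\<Prod>b\<in>(Basis :: (real^'n) set). f b) = (\<Prod>i\<in>UNIV. f (axis i 1))"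
proof -
  have "(Basis :: (real^'n) set) = range (\<lambda>i. axis i 1)"
    by (auto simp: Basis_vec_def)
  moreover have "inj (\<lambda>i. axis i (1::real) :: real^'n)"
    by (simp add: inj_on_def axis_eq_axis)
  ultimately show ?thesis
    using prod.reindex[of "\<lambda>i. axis i (1::real) :: real^'n" UNIV f] by (simp add: o_def)
qed

text \<open>\<open>lborel_eqI\<close> in coordinates: box volumes become products over the index
  type. The identifications of image measures with \<open>lborel\<close> below rest on this
  criterion.\<close>

lemma lborel_vec_eqI:
  fixes M :: "(real^'n) measure"
  assumes "\<And>l u. (\<And>i. l $ i \<le> u $ i) \<Longrightarrow> emeasure M (box l u) = (\<Prod>i\<in>UNIV. ennreal (u $ i - l $ i))"
    and "sets M = sets borel"
  shows "M = lborel"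
proof (rule lborel_eqI[symmetric])
  fix l u :: "real^'n"
  assume "\<And>b. b \<in> Basis \<Longrightarrow> l \<bullet> b \<le> u \<bullet> b"
  then have le: "l $ i \<le> u $ i" for i
    by (force simp: Basis_vec_def cart_eq_inner_axis)
  show "emeasure M (box l u) = ennreal (\<Prod>b\<in>Basis. (u - l) \<bullet> b)"
    using le by (simp add: assms(1) prod_Basis_vec cart_eq_inner_axis[symmetric] prod_ennreal)
qed (rule assms)

lemma emeasure_lborel_box_vec:
  fixes l u :: "real^'n"
  assumes "\<And>i. l $ i \<le> u $ i"
  shows "emeasure lborel (box l u) = (\<Prod>i\<in>UNIV. ennreal (u $ i - l $ i))"
proof -
  have "\<And>b. b \<in> Basis \<Longrightarrow> l \<bullet> b \<le> u \<bullet> b"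
    using assms by (auto simp: Basis_vec_def cart_eq_inner_axis[symmetric])
  then show ?thesis
    using assms by (simp add: prod_Basis_vec cart_eq_inner_axis[symmetric] prod_ennreal)
qed

text \<open>Only the sigma-algebra of \<open>N\<close> is prescribed, so that the lemma serves both
  \<open>lborel\<close> and \<open>density lborel g\<close>.\<close>

lemma measurable_vec_lambda_PiM:
  assumes "sets N = sets (borel :: real measure)"
  shows "(\<lambda>f. \<chi> i. f i) \<in> (\<Pi>\<^sub>M i\<in>(UNIV::'n::finite set). N) \<rightarrow>\<^sub>M borel"
proof -
  have "(\<lambda>f. f i) \<in> (\<Pi>\<^sub>M i\<in>(UNIV::'n set). N) \<rightarrow>\<^sub>M borel" for i
    using measurable_component_singleton[of i UNIV "\<lambda>_. N"] by (simp cong: measurable_cong_sets add: assms)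
  then show ?thesis
    by (subst borel_measurable_euclidean_space)
       (auto simp: Basis_vec_def cart_eq_inner_axis[symmetric])
qed

text \<open>Both measures give a box the product of its side lengths. This links vectors to the
  function spaces on which \<open>PiM\<close> lives.\<close>

lemma lborel_vec_eq_distr_PiM:
  "(lborel :: (real^'n) measure) = distr (\<Pi>\<^sub>M i\<in>UNIV. lborel) borel (\<lambda>f. \<chi> i. f i)"
proof (rule lborel_vec_eqI[symmetric])
  interpret product_sigma_finite "\<lambda>i::'n. lborel :: real measure" ..
  have [measurable]: "(\<lambda>f. \<chi> i. f i) \<in> (\<Pi>\<^sub>M i\<in>(UNIV::'n set). (lborel :: real measure)) \<rightarrow>\<^sub>M borel"
    by (rule measurable_vec_lambda_PiM) simp
  fix l u :: "real^'n" assume le: "\<And>i. l $ i \<le> u $ i"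
  have "(\<lambda>f. \<chi> i. f i) -` box l u \<inter> space (\<Pi>\<^sub>M i\<in>(UNIV::'n set). (lborel :: real measure))
      = (\<Pi>\<^sub>E i\<in>UNIV. {l $ i <..< u $ i})"
    by (auto simp: space_PiM mem_box_cart PiE_def Pi_iff)
  then show "emeasure (distr (\<Pi>\<^sub>M i\<in>UNIV. lborel) borel (\<lambda>f. \<chi> i. f i)) (box l u)
      = (\<Prod>i\<in>UNIV. ennreal (u $ i - l $ i))"
    using le by (simp add: emeasure_distr emeasure_PiM)
qed simp

text \<open>Rectangles determine a product measure. The indicator of a rectangle is the product of
  the indicators of its sides, so by Tonelli the integral over it factors.\<close>

lemma density_prod_PiM:
  fixes g :: "'b \<Rightarrow> 'a \<Rightarrow> ennreal"
  assumes "finite I" and "product_sigma_finite M" and "product_sigma_finite (\<lambda>i. density (M i) (g i))"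
    and [measurable]: "\<And>i. g i \<in> borel_measurable (M i)"
  shows "density (PiM I M) (\<lambda>x. \<Prod>i\<in>I. g i (x i)) = (\<Pi>\<^sub>M i\<in>I. density (M i) (g i))"
proof (rule product_sigma_finite.PiM_eqI)
  interpret product_sigma_finite M by fact
  show "product_sigma_finite (\<lambda>i. density (M i) (g i))" by fact
  show "sets (density (PiM I M) (\<lambda>x. \<Prod>i\<in>I. g i (x i))) = sets (\<Pi>\<^sub>M i\<in>I. density (M i) (g i))"
    by (simp cong: sets_PiM_cong)
  fix A assume A: "\<And>i. i \<in> I \<Longrightarrow> A i \<in> sets (density (M i) (g i))"
  then have [measurable]: "Pi\<^sub>E I A \<in> sets (PiM I M)"
    using \<open>finite I\<close> by (auto intro: sets_PiM_I_finite)
  have "emeasure (density (PiM I M) (\<lambda>x. \<Prod>i\<in>I. g i (x i))) (Pi\<^sub>E I A)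
      = (\<integral>\<^sup>+x. (\<Prod>i\<in>I. g i (x i)) * indicator (Pi\<^sub>E I A) x \<partial>PiM I M)"
    by (rule emeasure_density) measurable
  also have "\<dots> = (\<integral>\<^sup>+x. (\<Prod>i\<in>I. g i (x i) * indicator (A i) (x i)) \<partial>PiM I M)"
  proof (rule nn_integral_cong)
    fix x assume "x \<in> space (PiM I M)"
    then have "indicator (Pi\<^sub>E I A) x = (\<Prod>i\<in>I. indicator (A i) (x i) :: ennreal)"
      using \<open>finite I\<close> by (auto simp: indicator_def space_PiM PiE_def Pi_iff prod_zero_iff)
    then show "(\<Prod>i\<in>I. g i (x i)) * indicator (Pi\<^sub>E I A) x = (\<Prod>i\<in>I. g i (x i) * indicator (A i) (x i))"
      by (simp add: prod.distrib)
  qed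
  also have "\<dots> = (\<Prod>i\<in>I. \<integral>\<^sup>+x. g i x * indicator (A i) x \<partial>M i)"
    using A \<open>finite I\<close> by (intro product_nn_integral_prod) auto
  also have "\<dots> = (\<Prod>i\<in>I. emeasure (density (M i) (g i)) (A i))"
    using A by (intro prod.cong) (auto simp: emeasure_density)
  finally show "emeasure (density (PiM I M) (\<lambda>x. \<Prod>i\<in>I. g i (x i))) (Pi\<^sub>E I A)
      = (\<Prod>i\<in>I. emeasure (density (M i) (g i)) (A i))" .
qed fact

lemma density_prod_lborel_vec:
  fixes g :: "real \<Rightarrow> ennreal"
  assumes [measurable]: "g \<in> borel_measurable borel" and "prob_space (density lborel g)"
  shows "density lborel (\<lambda>x::real^'n. \<Prod>i\<in>UNIV. g (x $ i))
    = distr (\<Pi>\<^sub>M i\<in>UNIV. density lborel g) borel (\<lambda>f. \<chi> i. f i)"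
proof -
  interpret N: prob_space "density lborel g" by fact
  have [measurable]: "(\<lambda>f. \<chi> i. f i) \<in> (\<Pi>\<^sub>M i\<in>(UNIV::'n set). (lborel :: real measure)) \<rightarrow>\<^sub>M borel"
    by (rule measurable_vec_lambda_PiM) simp
  have "density lborel (\<lambda>x::real^'n. \<Prod>i\<in>UNIV. g (x $ i))
      = distr (density (\<Pi>\<^sub>M i\<in>UNIV. lborel) (\<lambda>f. \<Prod>i\<in>UNIV. g (f i))) borel (\<lambda>f. \<chi> i. f i)"
    by (subst lborel_vec_eq_distr_PiM, subst density_distr) (auto)
  also have "density (\<Pi>\<^sub>M i\<in>(UNIV::'n set). lborel) (\<lambda>f. \<Prod>i\<in>UNIV. g (f i)) = (\<Pi>\<^sub>M i\<in>UNIV. density lborel g)"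
  proof (rule density_prod_PiM)
    show "product_sigma_finite (\<lambda>i::'n. lborel :: real measure)" ..
    show "product_sigma_finite (\<lambda>i::'n. density lborel g)" ..
  qed auto
  finally show ?thesis .
qed

text \<open>A product density means independent coordinates. Keeping the \<open>Inr\<close>
  coordinates is a reindexing along an injection, and as all factors have mass 1, integrating out
  the others leaves the product of the remaining factors.\<close>

lemma distr_density_prod_bottom_rows:
  fixes g :: "real \<Rightarrow> ennreal"
  assumes [measurable]: "g \<in> borel_measurable borel" and "prob_space (density lborel g)"
  shows "distr (density lborel (\<lambda>x::real^('p::finite + 'q::finite). \<Prod>i\<in>UNIV. g (x $ i))) borel bottom_rows
    = density lborel (\<lambda>x::real^'q. \<Prod>i\<in>UNIV. g (x $ i))"
proof -
  interpret N: prob_space "density lborel g" by fact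
  interpret product_prob_space "\<lambda>i::'p + 'q. density lborel g" ..
  have [measurable]: "(\<lambda>f. \<chi> i. f i) \<in> (\<Pi>\<^sub>M i\<in>(UNIV::'n::finite set). density lborel g) \<rightarrow>\<^sub>M borel"
    by (rule measurable_vec_lambda_PiM) simp
  have [measurable]: "(bottom_rows :: real^('p + 'q) \<Rightarrow> _) \<in> borel_measurable borel"
    by (rule borel_measurable_euclidean_space[THEN iffD2])
       (auto simp: Basis_vec_def cart_eq_inner_axis[symmetric] bottom_rows_def)
  let ?P = "\<Pi>\<^sub>M i\<in>(UNIV :: ('p + 'q) set). density lborel g" and ?Q = "\<Pi>\<^sub>M i\<in>(UNIV :: 'q set). density lborel g"
  \<comment> \<open>The restriction to \<open>UNIV\<close> changes no value; it gives the map the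
    shape that \<open>distr_reorder\<close> expects.\<close>
  let ?t = "\<lambda>f. \<lambda>j\<in>(UNIV::'q set). f (Inr j :: 'p + 'q)"
  have "distr (distr ?P borel (\<lambda>f. \<chi> i. f i)) borel bottom_rows
      = distr ?P borel (\<lambda>f. \<chi> j. f (Inr j))"
    by (simp add: distr_distr o_def bottom_rows_def)
  also have "\<dots> = distr (distr ?P ?Q ?t) borel (\<lambda>f. \<chi> j. f j)"
    by (subst distr_distr) (auto simp: o_def fun_eq_iff vec_eq_iff intro!: measurable_restrict arg_cong[where f="distr _ _"])
  also have "distr ?P ?Q ?t = ?Q"
    by (rule distr_reorder) (auto simp: inj_on_def)
  finally show ?thesis
    using assms(2) by (simp add: density_prod_lborel_vec)
qed

section \<open>Invariance of Lebesgue measure under relabelling of coordinates and orthogonal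
  maps\<close>

text \<open>The preimage of a box is the box with relabelled sides. The two index types may differ,
  as they do in the passage to the well-ordered copy.\<close>

lemma distr_lborel_reindex:
  fixes h :: "'m::finite \<Rightarrow> 'n::finite"
  assumes "bij h"
  shows "distr lborel borel (\<lambda>x::real^'n. \<chi> i. x $ h i) = (lborel :: (real^'m) measure)"
proof (rule lborel_vec_eqI)
  have [measurable]: "(\<lambda>x::real^'n. \<chi> i. x $ h i) \<in> borel_measurable borel"
    by (rule borel_measurable_euclidean_space[THEN iffD2])
       (auto simp: Basis_vec_def cart_eq_inner_axis[symmetric])
  fix l u :: "real^'m" assume le: "\<And>i. l $ i \<le> u $ i"
  have h: "h (inv h j) = j" "inv h (h i) = i" for i j
    using assms by (simp_all add: bij_is_surj surj_f_inv_f bij_is_inj)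
  have "(\<lambda>x::real^'n. \<chi> i. x $ h i) -` box l u = box (\<chi> j. l $ inv h j) (\<chi> j. u $ inv h j)"
    by (auto simp: mem_box_cart) (metis h)+
  then show "emeasure (distr lborel borel (\<lambda>x::real^'n. \<chi> i. x $ h i)) (box l u)
      = (\<Prod>i\<in>UNIV. ennreal (u $ i - l $ i))"
    using le prod.reindex_bij_betw[OF assms, of "\<lambda>j. ennreal (u $ inv h j - l $ inv h j)"]
    by (simp add: emeasure_distr emeasure_lborel_box_vec h)
qed simp

text \<open>
  The change-of-variables theorems of the library need a well-ordered index type. This is a copy of
  an arbitrary finite type with such an order.
\<close>

typedef 'n wo_copy = "UNIV :: 'n set" ..

instance wo_copy :: (finite) finite
proof
  have "inj (Rep_wo_copy :: 'a wo_copy \<Rightarrow> 'a)"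
    by (simp add: inj_on_def Rep_wo_copy_inject)
  then show "finite (UNIV :: 'a wo_copy set)"
    by (rule finite_imageD[rotated]) simp
qed

text \<open>The order is pulled back along the injection \<open>to_nat\<close>, and well-foundedness
  comes from the natural numbers.\<close>

instantiation wo_copy :: (finite) wellorder
begin

definition less_eq_wo_copy :: "'a wo_copy \<Rightarrow> 'a wo_copy \<Rightarrow> bool"
  where "x \<le> y \<longleftrightarrow> to_nat (Rep_wo_copy x) \<le> to_nat (Rep_wo_copy y)"

definition less_wo_copy :: "'a wo_copy \<Rightarrow> 'a wo_copy \<Rightarrow> bool"
  where "x < y \<longleftrightarrow> to_nat (Rep_wo_copy x) < to_nat (Rep_wo_copy y)"

instance
proof
  fix x y z :: "'a wo_copy"
  show "x < y \<longleftrightarrow> x \<le> y \<and> \<not> y \<le> x"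
    by (auto simp: less_eq_wo_copy_def less_wo_copy_def)
  show "x \<le> x" and "x \<le> y \<or> y \<le> x"
    by (auto simp: less_eq_wo_copy_def)
  show "x \<le> y \<Longrightarrow> y \<le> z \<Longrightarrow> x \<le> z"
    by (simp add: less_eq_wo_copy_def)
  show "x \<le> y \<Longrightarrow> y \<le> x \<Longrightarrow> x = y"
    by (metis Rep_wo_copy_inject eq_iff from_nat_to_nat less_eq_wo_copy_def)
next
  fix P :: "'a wo_copy \<Rightarrow> bool" and a :: "'a wo_copy"
  assume step: "\<And>x. (\<And>y. y < x \<Longrightarrow> P y) \<Longrightarrow> P x"
  show "P a"
  proof (induction "to_nat (Rep_wo_copy a)" arbitrary: a rule: less_induct)
    case less
    show ?case
      by (rule step, rule less) (simp add: less_wo_copy_def)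
  qed
qed

end

text \<open>The preimage of a box under \<open>f\<close> is its image under the orthogonal map
  \<open>inv f\<close>, which has the same measure.\<close>

lemma distr_lborel_orthogonal_wo:
  fixes f :: "real^'n::{finite,wellorder} \<Rightarrow> real^'n::_"
  assumes f: "orthogonal_transformation f"
  shows "distr lborel borel f = lborel"
proof (rule lborel_vec_eqI)
  have lin: "linear f"
    using f by (rule orthogonal_transformation_linear)
  then have [measurable]: "f \<in> borel_measurable borel"
    by (simp add: borel_measurable_continuous_onI linear_continuous_on linear_linear)
  fix l u :: "real^'n::_" assume le: "\<And>i. l $ i \<le> u $ i"
  have "bij f" using f by (rule orthogonal_transformation_bij)
  then have vi: "f -` box l u = inv f ` box l u"
    by (rule bij_vimage_eq_inv_image)
  have g: "orthogonal_transformation (inv f)"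
    using f by (rule orthogonal_transformation_inv)
  have m: "inv f ` box l u \<in> sets borel"
    using measurable_sets[of f borel borel "box l u"] by (simp add: vi)
  \<comment> \<open>The image theorem is about the completed measure \<open>lebesgue\<close>; it
    agrees with \<open>lborel\<close> here because the image of the box is a Borel set.\<close>
  have "emeasure (distr lborel borel f) (box l u) = emeasure lebesgue (inv f ` box l u)"
    using m by (simp add: emeasure_distr vi)
  also have "\<dots> = ennreal (measure lebesgue (inv f ` box l u))"
    by (intro emeasure_eq_measure2 measurable_orthogonal_image g lmeasurable_box)
  also have "\<dots> = ennreal (measure lebesgue (box l u))"
    by (simp only: measure_orthogonal_image[OF g lmeasurable_box])
  also have "\<dots> = emeasure lebesgue (box l u)"
    by (rule emeasure_eq_measure2[OF lmeasurable_box, symmetric])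
  also have "\<dots> = emeasure lborel (box l u)"
    by simp
  finally show "emeasure (distr lborel borel f) (box l u) = (\<Prod>i\<in>UNIV. ennreal (u $ i - l $ i))"
    using le by (simp add: emeasure_lborel_box_vec)
qed simp

text \<open>Relabelling the coordinates by \<open>r\<close> and \<open>s\<close> turns
  \<open>f\<close> into the orthogonal map \<open>r \<circ> f \<circ> s\<close> over the
  well-ordered copy. Since \<open>s\<close> carries Lebesgue measure to Lebesgue measure and
  \<open>f \<circ> s = s \<circ> (r \<circ> f \<circ> s)\<close>, the invariance passes to
  \<open>f\<close>.\<close>

lemma distr_lborel_orthogonal:
  fixes f :: "real^'n \<Rightarrow> real^'n"
  assumes f: "orthogonal_transformation f"
  shows "distr lborel borel f = lborel"
proof -
  define r :: "real^'n \<Rightarrow> real^'n wo_copy" where "r x = (\<chi> i. x $ Rep_wo_copy i)" for x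
  define s :: "real^'n wo_copy \<Rightarrow> real^'n" where "s x = (\<chi> i. x $ Abs_wo_copy i)" for x
  have rs: "r (s x) = x" "s (r y) = y" for x y
    by (simp_all add: r_def s_def vec_eq_iff Rep_wo_copy_inverse Abs_wo_copy_inverse)
  have lin: "linear f" using f by (rule orthogonal_transformation_linear)
  have lr: "linear r" "linear s"
    by (auto simp: r_def s_def linear_iff vec_eq_iff)
  have [measurable]: "f \<in> borel_measurable borel" "r \<in> borel_measurable borel" "s \<in> borel_measurable borel"
    using lin lr by (simp_all add: borel_measurable_continuous_onI linear_continuous_on linear_linear)
  have bA: "bij (Abs_wo_copy :: 'n \<Rightarrow> _)"
    by (rule o_bij[of Rep_wo_copy]) (auto simp: Abs_wo_copy_inverse Rep_wo_copy_inverse)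
  have s: "distr lborel borel s = lborel"
    unfolding s_def using bA by (rule distr_lborel_reindex)
  have ns: "norm (s x) = norm x" for x
    unfolding norm_vec_def L2_set_def s_def using sum.reindex_bij_betw[OF bA, of "\<lambda>i. (norm (x $ i))\<^sup>2"] by simp
  have nr: "norm (r x) = norm x" for x
    using ns[of "r x"] by (simp add: rs)
  have "orthogonal_transformation (r \<circ> f \<circ> s)"
    unfolding orthogonal_transformation
    using linear_compose[OF lr(2) linear_compose[OF lin lr(1)]] orthogonal_transformation_norm[OF f]
    by (simp add: nr ns o_assoc)
  then have *: "distr lborel borel (r \<circ> f \<circ> s) = lborel"
    by (rule distr_lborel_orthogonal_wo)
  have "distr lborel borel f = distr (distr lborel borel s) borel f"
    by (simp add: s)
  also have "\<dots> = distr lborel borel (s \<circ> (r \<circ> f \<circ> s))"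
    by (simp add: distr_distr o_def rs)
  also have "\<dots> = distr (distr lborel borel (r \<circ> f \<circ> s)) borel s"
    by (rule distr_distr[symmetric]) (auto simp: o_def)
  also have "\<dots> = lborel"
    by (simp add: * s)
  finally show ?thesis .
qed

subsection \<open>The normal distribution with scalar covariance matrix\<close>

text \<open>\<open>matrix_inv\<close> is defined by a choice; uniqueness of two-sided inverses
  identifies the chosen matrix with \<open>B\<close>.\<close>

lemma matrix_inv_eqI:
  fixes A :: "'a::semiring_1^'n^'m"
  assumes "A ** B = mat 1" and "B ** A = mat 1"
  shows "matrix_inv A = B"
proof -
  have "A ** matrix_inv A = mat 1 \<and> matrix_inv A ** A = mat 1"
    unfolding matrix_inv_def by (rule someI[of _ B]) (simp add: assms)
  then show ?thesis
    by (metis assms(2) matrix_mul_assoc matrix_mul_lid matrix_mul_rid)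
qed

lemma matrix_inv_mult:
  fixes A :: "'a::semiring_1^'n^'m"
  assumes "invertible A"
  shows "A ** matrix_inv A = mat 1" and "matrix_inv A ** A = mat 1"
  using assms matrix_inv_eqI unfolding invertible_def by metis+

lemma matrix_inv_scaled_mat_1:
  fixes c :: real
  assumes "c \<noteq> 0"
  shows "matrix_inv (c *\<^sub>R mat 1 :: real^'n^'n) = (1 / c) *\<^sub>R mat 1"
  using assms by (intro matrix_inv_eqI)
    (simp_all add: scalar_matrix_assoc[unfolded scalar_mult_eq_scaleR, symmetric] matrix_scalar_ac[unfolded scalar_mult_eq_scaleR])

text \<open>The determinant is a power and the quadratic form a scaled sum of squares, so the
  density factors. The absolute value is there because \<open>\<sigma>\<close> may be negative,
  while \<open>prob_space_normal_density\<close> wants a positive deviation.\<close>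

lemma mvn_density_scalar_covariance:
  fixes x :: "real^'n"
  assumes "\<sigma> \<noteq> 0"
  shows "mvn_density 0 (\<sigma>\<^sup>2 *\<^sub>R mat 1) x = (\<Prod>i\<in>UNIV. normal_density 0 \<bar>\<sigma>\<bar> (x $ i))"
proof -
  have "det (\<sigma>\<^sup>2 *\<^sub>R mat 1 :: real^'n^'n) = (\<sigma>\<^sup>2) ^ CARD('n)"
    by (subst det_diagonal) (simp_all add: mat_def)
  then have "sqrt ((2 * pi) ^ CARD('n) * det (\<sigma>\<^sup>2 *\<^sub>R mat 1 :: real^'n^'n)) = sqrt (2 * pi * \<sigma>\<^sup>2) ^ CARD('n)"
    by (simp only: power_mult_distrib[symmetric] real_sqrt_power)
  moreover have "x \<bullet> (matrix_inv (\<sigma>\<^sup>2 *\<^sub>R mat 1) *v x) = (\<Sum>i\<in>UNIV. (x $ i)\<^sup>2 / \<sigma>\<^sup>2)"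
    using assms by (simp add: matrix_inv_scaled_mat_1 scaleR_matrix_vector_assoc[symmetric] inner_vec_def
        sum_divide_distrib power2_eq_square)
  ultimately show ?thesis
    by (simp add: mvn_density_def normal_density_def prod.distrib prod_dividef exp_sum[symmetric]
        sum_divide_distrib[symmetric] sum_negf divide_divide_eq_left)
qed

lemma measurable_mvn_density:
  assumes "\<sigma> \<noteq> 0"
  shows "mvn_density 0 (\<sigma>\<^sup>2 *\<^sub>R mat 1) \<in> borel_measurable borel"
  unfolding mvn_density_scalar_covariance[OF assms, abs_def] by measurable

text \<open>The density depends on \<open>x\<close> only through \<open>x \<bullet> x\<close>, and
  Lebesgue measure is invariant under \<open>f\<close>.\<close>

lemma distributed_mvn_orthogonal_transformation:
  fixes Z :: "'a \<Rightarrow> real^'n" and f :: "real^'n \<Rightarrow> real^'n"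
  assumes Z: "distributed M lborel Z (mvn_density 0 (\<sigma>\<^sup>2 *\<^sub>R mat 1))"
    and "\<sigma> \<noteq> 0" and f: "orthogonal_transformation f"
  shows "distributed M lborel (\<lambda>\<omega>. f (Z \<omega>)) (mvn_density 0 (\<sigma>\<^sup>2 *\<^sub>R mat 1))"
proof -
  let ?g = "mvn_density 0 (\<sigma>\<^sup>2 *\<^sub>R mat 1) :: real^'n \<Rightarrow> real"
  have [measurable]: "?g \<in> borel_measurable borel"
    using \<open>\<sigma> \<noteq> 0\<close> by (rule measurable_mvn_density)
  have [measurable]: "f \<in> borel_measurable borel"
    using orthogonal_transformation_linear[OF f]
    by (simp add: borel_measurable_continuous_onI linear_continuous_on linear_linear)
  have [measurable]: "Z \<in> M \<rightarrow>\<^sub>M borel"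
    using Z by (simp add: distributed_def)
  have g: "?g (f x) = ?g x" for x
    using f \<open>\<sigma> \<noteq> 0\<close> by (simp add: mvn_density_def matrix_inv_scaled_mat_1
        scaleR_matrix_vector_assoc[symmetric] orthogonal_transformation_def)
  have "distr M lborel (\<lambda>\<omega>. f (Z \<omega>)) = distr (distr M lborel Z) borel f"
    by (simp add: distr_distr o_def cong: distr_cong)
  \<comment> \<open>Writing the density as a function of \<open>f x\<close> is what allows
    \<open>density_distr\<close> to move it outside the image measure.\<close>
  also have "\<dots> = distr (density lborel (\<lambda>x. ennreal (?g (f x)))) borel f"
    using Z by (simp add: distributed_def g)
  also have "\<dots> = density (distr lborel borel f) (\<lambda>x. ennreal (?g x))"
    by (rule density_distr[symmetric]) auto
  finally show ?thesis
    by (simp add: distributed_def distr_lborel_orthogonal[OF f])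
qed

lemma distributed_mvn_bottom_rows:
  fixes Z :: "'a \<Rightarrow> real^('p::finite + 'q::finite)"
  assumes Z: "distributed M lborel Z (mvn_density 0 (\<sigma>\<^sup>2 *\<^sub>R mat 1))" and "\<sigma> \<noteq> 0"
  shows "distributed M lborel (\<lambda>\<omega>. bottom_rows (Z \<omega>)) (mvn_density 0 (\<sigma>\<^sup>2 *\<^sub>R mat 1))"
proof -
  let ?n = "\<lambda>t. ennreal (normal_density 0 \<bar>\<sigma>\<bar> t)"
  have mvn: "ennreal (mvn_density 0 (\<sigma>\<^sup>2 *\<^sub>R mat 1) x) = (\<Prod>i\<in>UNIV. ?n (x $ i))" for x :: "real^'n"
    using \<open>\<sigma> \<noteq> 0\<close> by (simp add: mvn_density_scalar_covariance prod_ennreal)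
  have [measurable]: "Z \<in> M \<rightarrow>\<^sub>M borel"
    using Z by (simp add: distributed_def)
  have [measurable]: "(bottom_rows :: real^('p + 'q) \<Rightarrow> _) \<in> borel_measurable borel"
    by (rule borel_measurable_euclidean_space[THEN iffD2])
       (auto simp: Basis_vec_def cart_eq_inner_axis[symmetric] bottom_rows_def)
  have "distr M lborel (\<lambda>\<omega>. bottom_rows (Z \<omega>)) = distr (distr M lborel Z) borel bottom_rows"
    by (simp add: distr_distr o_def cong: distr_cong)
  also have "\<dots> = density lborel (\<lambda>x. ennreal (mvn_density 0 (\<sigma>\<^sup>2 *\<^sub>R mat 1) x))"
    using Z \<open>\<sigma> \<noteq> 0\<close> distr_density_prod_bottom_rows[of ?n] prob_space_normal_density[of "\<bar>\<sigma>\<bar>" 0]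
    by (simp add: distributed_def mvn)
  finally show ?thesis
    using measurable_mvn_density[OF \<open>\<sigma> \<noteq> 0\<close>, where ?'a='q] by (simp add: distributed_def)
qed

subsection \<open>Column spaces and residuals\<close>

lemma inner_transpose_mult:
  fixes A :: "real^'m^'n"
  shows "(transpose A *v x) \<bullet> y = x \<bullet> (A *v y)"
  by (simp add: transpose_matrix_vector dot_lmul_matrix)

lemma orthonormal_columns_inner:
  assumes "orthonormal_columns A"
  shows "(A *v x) \<bullet> (A *v y) = x \<bullet> y"
proof -
  have "transpose A ** A = mat 1"
    using assms by (simp add: orthonormal_columns_def matrix_mult_transpose_dot_column vec_eq_iff mat_def)
  then show ?thesis
    by (metis inner_commute inner_transpose_mult matrix_vector_mul_assoc matrix_vector_mul_lid)
qed

text \<open>By polarization a linear isometry preserves inner products, in particular those of the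
  basis vectors, whose images are the columns.\<close>

lemma orthonormal_columnsI:
  assumes "\<And>x. norm (A *v x) = norm x"
  shows "orthonormal_columns A"
proof -
  have "(A *v x) \<bullet> (A *v y) = x \<bullet> y" for x y
    using assms by (simp add: dot_norm matrix_vector_right_distrib[symmetric])
  then show ?thesis
    by (simp add: orthonormal_columns_def matrix_vector_mult_basis[symmetric])
       (simp add: inner_axis_axis)
qed

text \<open>The columns of \<open>Q\<close> complete those of \<open>N\<close> to an orthonormal
  basis. With these as rows, \<open>U\<close> is orthogonal, and \<open>transpose N *v z\<close> is
  the last block of \<open>U *v z\<close>.\<close>

lemma distributed_mvn_transpose_orthonormal_columns:
  fixes Z :: "'a \<Rightarrow> real^('p::finite + 'q::finite)" and Q :: "real^'p^('p + 'q)" and N :: "real^'q^('p + 'q)"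
  assumes Z: "distributed M lborel Z (mvn_density 0 (\<sigma>\<^sup>2 *\<^sub>R mat 1))" and "\<sigma> \<noteq> 0"
    and Q: "orthonormal_columns Q" and N: "orthonormal_columns N"
    and QN: "\<And>i j. column i Q \<bullet> column j N = 0"
  shows "distributed M lborel (\<lambda>\<omega>. transpose N *v Z \<omega>) (mvn_density 0 (\<sigma>\<^sup>2 *\<^sub>R mat 1))"
proof -
  define U :: "real^('p + 'q)^('p + 'q)"
    where "U = (\<chi> i. case i of Inl a \<Rightarrow> column a Q | Inr b \<Rightarrow> column b N)"
  have row: "row i U = (case i of Inl a \<Rightarrow> column a Q | Inr b \<Rightarrow> column b N)" for i
    by (simp add: U_def row_def)
  have "row i U \<bullet> row j U = (if i = j then 1 else 0)" for i j
    using Q N QN by (auto simp: row orthonormal_columns_def inner_commute split: sum.split)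
  then have "orthogonal_matrix U"
    by (simp add: orthogonal_matrix_orthonormal_rows norm_eq_1 orthogonal_def)
  then have "orthogonal_transformation ((*v) U)"
    by (simp add: orthogonal_transformation_matrix)
  from distributed_mvn_bottom_rows[OF distributed_mvn_orthogonal_transformation[OF Z \<open>\<sigma> \<noteq> 0\<close> this] \<open>\<sigma> \<noteq> 0\<close>]
  have "distributed M lborel (\<lambda>\<omega>. bottom_rows (U *v Z \<omega>) :: real^'q) (mvn_density 0 (\<sigma>\<^sup>2 *\<^sub>R mat 1))" .
  moreover have "bottom_rows (U *v z) = transpose N *v z" for z
    by (simp add: vec_eq_iff bottom_rows_def U_def matrix_vector_mult_def transpose_def column_def)
  ultimately show ?thesis by simp
qed

lemma col_space_eq_range: "col_space A = range ((*v) A)"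
proof
  have "columns A \<subseteq> range ((*v) A)"
    by (auto simp: columns_image_basis)
  then show "col_space A \<subseteq> range ((*v) A)"
    unfolding col_space_def by (intro span_minimal linear_subspace_image) auto
  show "range ((*v) A) \<subseteq> col_space A"
    using matrix_vector_mult_in_columnspace[of A] by (auto simp: col_space_def)
qed

lemma mem_orthogonal_comp_col_space:
  "x \<in> orthogonal_comp (col_space A) \<longleftrightarrow> (\<forall>u. x \<bullet> (A *v u) = 0)"
  by (auto simp: orthogonal_comp_def col_space_eq_range orthogonal_def inner_commute)

text \<open>A vector \<open>z\<close> in the kernel satisfies
  \<open>(X *v z) \<bullet> (X *v z) = 0\<close>, and \<open>X\<close> is injective by full column
  rank.\<close>

lemma invertible_gram:
  fixes X :: "real^'p^'n"
  assumes "rank X = CARD('p)"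
  shows "invertible (transpose X ** X)"
proof -
  have "z = 0" if "(transpose X ** X) *v z = 0" for z
  proof -
    have "(X *v z) \<bullet> (X *v z) = 0"
      using that by (metis inner_transpose_mult inner_zero_left matrix_vector_mul_assoc)
    then have "X *v z = X *v 0" by simp
    then show "z = 0"
      using assms full_rank_injective[of X] by (metis injD)
  qed
  then show ?thesis
    by (metis invertible_left_inverse matrix_left_invertible_ker)
qed

text \<open>These are the normal equations: \<open>transpose X\<close> annihilates the
  residual.\<close>

lemma residual_orthogonal_comp:
  fixes X :: "real^'p^'n"
  assumes "rank X = CARD('p)"
  shows "residual X y \<in> orthogonal_comp (col_space X)"
proof -
  have "transpose X *v residual X y = transpose X *v y -
      ((transpose X ** X) ** matrix_inv (transpose X ** X)) *v (transpose X *v y)"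
    by (simp add: residual_def ols_estimate_def matrix_vector_mult_diff_distrib matrix_vector_mul_assoc matrix_mul_assoc)
  also have "\<dots> = 0"
    by (simp add: matrix_inv_mult[OF invertible_gram[OF assms]])
  finally have "residual X y \<bullet> (X *v u) = 0" for u
    by (metis inner_transpose_mult inner_zero_left)
  then show ?thesis
    by (simp add: mem_orthogonal_comp_col_space)
qed

text \<open>The common end of all three cases. The law of \<open>W\<close> comes from the noise
  \<open>Y - X \<beta>\<close>, its norm from the fact that the residual lies in the column space of
  \<open>N\<close>, where \<open>transpose N\<close> is isometric.\<close>

lemma transformed_residuals:
  fixes X :: "real^'p::finite^('p + 'q::finite)" and N :: "real^'q^('p + 'q)" and D :: "real^'p^'p"
  assumes X: "rank X = CARD('p)" and "\<sigma> \<noteq> 0"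
    and Y: "distributed M lborel (\<lambda>\<omega>. Y \<omega> - X *v \<beta>) (mvn_density 0 (\<sigma>\<^sup>2 *\<^sub>R mat 1))"
    and Q: "orthonormal_columns (X ** D)"
    and N: "orthonormal_columns N" "col_space N = orthogonal_comp (col_space X)"
    and W: "\<And>\<omega>. \<omega> \<in> space M \<Longrightarrow> W \<omega> = transpose N *v residual X (Y \<omega>)"
  shows "distributed M lborel W (mvn_density 0 (\<sigma>\<^sup>2 *\<^sub>R mat 1))
    \<and> (\<forall>\<omega>\<in>space M. W \<omega> \<bullet> W \<omega> = residual X (Y \<omega>) \<bullet> residual X (Y \<omega>))"
proof
  have NX: "(N *v w) \<bullet> (X *v u) = 0" for w u
    using N(2) by (metis col_space_eq_range mem_orthogonal_comp_col_space rangeI)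
  then have "transpose N *v (X *v u) = 0" for u
    by (metis inner_transpose_mult inner_commute inner_eq_zero_iff)
  \<comment> \<open>The fitted values and \<open>X *v \<beta>\<close> both lie in the column space
    of \<open>X\<close>, which \<open>transpose N\<close> annihilates, so the residual may be
    exchanged for the noise.\<close>
  then have "W \<omega> = transpose N *v (Y \<omega> - X *v \<beta>)" if "\<omega> \<in> space M" for \<omega>
    using that by (simp add: W residual_def matrix_vector_mult_diff_distrib)
  moreover have "distributed M lborel (\<lambda>\<omega>. transpose N *v (Y \<omega> - X *v \<beta>)) (mvn_density 0 (\<sigma>\<^sup>2 *\<^sub>R mat 1))"
  proof (rule distributed_mvn_transpose_orthonormal_columns[OF Y \<open>\<sigma> \<noteq> 0\<close> Q N(1)])
    show "column i (X ** D) \<bullet> column j N = 0" for i j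
      by (subst inner_commute) (simp add: NX flip: matrix_vector_mult_basis matrix_vector_mul_assoc)
  qed
  ultimately show "distributed M lborel W (mvn_density 0 (\<sigma>\<^sup>2 *\<^sub>R mat 1))"
    \<comment> \<open>\<open>W\<close> is known only on \<open>space M\<close>, hence the congruence
      rules for \<open>distr\<close> and measurability.\<close>
    by (simp add: distributed_def cong: distr_cong measurable_cong)
  show "\<forall>\<omega>\<in>space M. W \<omega> \<bullet> W \<omega> = residual X (Y \<omega>) \<bullet> residual X (Y \<omega>)"
  proof
    fix \<omega> assume "\<omega> \<in> space M"
    obtain u where u: "residual X (Y \<omega>) = N *v u"
      using residual_orthogonal_comp[OF X, of "Y \<omega>"] N(2) by (auto simp: col_space_eq_range)
    have "(transpose N *v (N *v u)) \<bullet> z = u \<bullet> z" for z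
      unfolding inner_transpose_mult using N(1) by (rule orthonormal_columns_inner)
    then have "transpose N *v (N *v u) = u"
      using vector_eq_rdot by blast
    with \<open>\<omega> \<in> space M\<close> show "W \<omega> \<bullet> W \<omega> = residual X (Y \<omega>) \<bullet> residual X (Y \<omega>)"
      by (simp add: W u orthonormal_columns_inner[OF N(1)])
  qed
qed

section \<open>An orthonormal basis of the orthogonal complement in case (ii)\<close>

lemma inner_sum_rows:
  fixes x y :: "real^('p::finite + 'q::finite)"
  shows "x \<bullet> y = top_rows x \<bullet> top_rows y + bottom_rows x \<bullet> bottom_rows y"
  by (simp add: inner_vec_def top_rows_def bottom_rows_def UNIV_Plus_UNIV[symmetric] sum.Plus del: UNIV_Plus_UNIV)

lemma rows_mult:
  shows "top_rows (A *v x) = top_rows A *v x" and "bottom_rows (A *v x) = bottom_rows A *v x"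
  by (simp_all add: top_rows_def bottom_rows_def matrix_vector_mult_def vec_eq_iff)

text \<open>One inclusion is the orthogonality assumption. Equality follows by counting dimensions:
  \<open>N\<close> is injective, and the complement has dimension
  \<open>CARD('p + 'q) - CARD('p)\<close>.\<close>

lemma col_space_eq_orthogonal_comp:
  fixes X :: "real^'p::finite^('p + 'q::finite)" and N :: "real^'q^('p + 'q)"
  assumes X: "rank X = CARD('p)" and N: "orthonormal_columns N"
    and NX: "\<And>u w. (N *v w) \<bullet> (X *v u) = 0"
  shows "col_space N = orthogonal_comp (col_space X)"
proof (rule subspace_dim_equal)
  show "subspace (col_space N)" "subspace (orthogonal_comp (col_space X))"
    by (simp_all add: col_space_def subspace_orthogonal_comp)
  show "col_space N \<subseteq> orthogonal_comp (col_space X)"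
    using NX by (auto simp: mem_orthogonal_comp_col_space col_space_eq_range[of N])
  have "inj ((*v) N)"
    by (metis (no_types, lifting) N injI orthonormal_columns_inner vector_eq)
  then have "dim (col_space N) = CARD('q)"
    by (simp add: col_space_eq_range flip: rank_dim_range full_rank_injective)
  moreover have "dim (col_space X) = CARD('p)"
    by (simp add: col_space_eq_range X flip: rank_dim_range)
  moreover have "dim (orthogonal_comp (col_space X)) + dim (col_space X) = CARD('p + 'q)"
    using dim_subspace_orthogonal_to_vectors[of "col_space X" UNIV]
    by (simp add: orthogonal_comp_def col_space_def)
  ultimately show "dim (orthogonal_comp (col_space X)) \<le> dim (col_space N)"
    by simp
qed

text \<open>The vector \<open>b u\<close> is chosen so that \<open>f u\<close>, which is
  \<open>(b u, u)\<close> minus \<open>?Q *v b u\<close>, is orthogonal to the column space of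
  \<open>X\<close>. Then \<open>f\<close> is an isometry, and its matrix is the required
  \<open>N\<close>.\<close>

lemma orthonormal_complement_exists:
  fixes X :: "real^'p::finite^('p + 'q::finite)"
  assumes X: "rank X = CARD('p)" and C: "invertible C" "orthonormal_columns (X ** matrix_inv C)"
    and CX: "invertible (C - top_rows X)"
  obtains N :: "real^'q^('p + 'q)"
  where "orthonormal_columns N" "col_space N = orthogonal_comp (col_space X)"
    "\<And>x. x \<in> orthogonal_comp (col_space X) \<Longrightarrow>
      transpose N *v x = bottom_rows x + bottom_rows X *v (matrix_inv (C - top_rows X) *v top_rows x)"
proof -
  let ?Z = "C - top_rows X" and ?Q = "X ** matrix_inv C"
  define b where "b u = transpose (matrix_inv ?Z) *v (transpose (bottom_rows X) *v u)" for u :: "real^'q"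
  define f :: "real^'q \<Rightarrow> real^('p + 'q)"
    where "f u = (\<chi> i. case i of Inl a \<Rightarrow> b u $ a | Inr c \<Rightarrow> u $ c) - ?Q *v b u" for u
  have f: "x \<bullet> f u = top_rows x \<bullet> b u + bottom_rows x \<bullet> u - x \<bullet> (?Q *v b u)" for x u
    by (simp add: f_def inner_diff_right inner_sum_rows[of x "\<chi> i. _ i"])
       (simp add: top_rows_def bottom_rows_def)
  have "linear b"
    unfolding b_def by (simp add: matrix_vector_mul_assoc del: transpose_matrix_vector)
  then have lin: "linear f"
    unfolding f_def
    by (intro linearI) (auto simp: vec_eq_iff linear_add[OF \<open>linear b\<close>] linear_scale[OF \<open>linear b\<close>] matrix_vector_right_distrib
        matrix_vector_mult_scaleR algebra_simps split: sum.split)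
  \<comment> \<open>This is the equation that dictates the formula for \<open>b\<close>: the inverse
    in it cancels \<open>?Z\<close> after passing to the adjoint.\<close>
  have b: "(?Z *v y) \<bullet> b u = (bottom_rows X *v y) \<bullet> u" for y u
  proof -
    have "matrix_inv ?Z *v (?Z *v y) = y"
      by (simp add: matrix_vector_mul_assoc matrix_inv_mult[OF CX])
    then have "b u \<bullet> (?Z *v y) = u \<bullet> (bottom_rows X *v y)"
      by (simp only: b_def inner_transpose_mult)
    then show ?thesis
      by (simp add: inner_commute)
  qed
  have QC: "?Q *v (C *v y) = X *v y" for y
    by (simp add: matrix_vector_mul_assoc matrix_inv_mult[OF C(1)] flip: matrix_mul_assoc)
  have fX: "(X *v y) \<bullet> f u = 0" for y u
  proof -
    have "(X *v y) \<bullet> (?Q *v b u) = (C *v y) \<bullet> b u"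
      by (metis QC orthonormal_columns_inner[OF C(2)])
    also have "\<dots> = (?Z *v y) \<bullet> b u + (top_rows X *v y) \<bullet> b u"
      by (simp add: matrix_vector_mult_diff_rdistrib inner_diff_left)
    finally show ?thesis
      by (simp add: f b rows_mult)
  qed
  \<comment> \<open>Pythagoras: \<open>(b u, u)\<close> is the sum of the orthogonal vectors
    \<open>f u\<close> and \<open>?Q *v b u\<close>, and the latter has the norm of
    \<open>b u\<close>.\<close>
  have "norm (f u) = norm u" for u
  proof -
    have "(?Q *v b u) \<bullet> f u = 0"
      using fX[of "matrix_inv C *v b u" u] by (simp add: matrix_vector_mul_assoc)
    then have "f u \<bullet> f u = (f u + ?Q *v b u) \<bullet> f u"
      by (simp add: inner_add_left)
    also have "\<dots> = top_rows (f u + ?Q *v b u) \<bullet> b u + bottom_rows (f u + ?Q *v b u) \<bullet> u - (f u + ?Q *v b u) \<bullet> (?Q *v b u)"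
      by (rule f)
    also have "top_rows (f u + ?Q *v b u) = b u"
      by (simp add: f_def top_rows_def vec_eq_iff)
    also have "bottom_rows (f u + ?Q *v b u) = u"
      by (simp add: f_def bottom_rows_def vec_eq_iff)
    also have "(f u + ?Q *v b u) \<bullet> (?Q *v b u) = b u \<bullet> b u"
      using \<open>(?Q *v b u) \<bullet> f u = 0\<close>
      by (simp add: inner_add_left inner_commute[of "f u"] orthonormal_columns_inner[OF C(2)])
    finally show ?thesis
      by (simp add: norm_eq_sqrt_inner)
  qed
  moreover have N: "matrix f *v u = f u" for u
    using lin by (simp add: matrix_works linear_linear)
  ultimately have on: "orthonormal_columns (matrix f)"
    by (intro orthonormal_columnsI) simp
  show thesis
  proof
    show "orthonormal_columns (matrix f)" by fact
    show "col_space (matrix f) = orthogonal_comp (col_space X)"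
      using fX by (intro col_space_eq_orthogonal_comp X on) (simp add: N inner_commute)
    fix x assume "x \<in> orthogonal_comp (col_space X)"
    then have x: "x \<bullet> (?Q *v y) = 0" for y
      by (simp add: mem_orthogonal_comp_col_space flip: matrix_vector_mul_assoc)
    \<comment> \<open>The \<open>?Q\<close> part of \<open>f u\<close> is orthogonal to
      \<open>x\<close>; in the remaining terms \<open>b\<close> is moved to the other side with
      \<open>y = matrix_inv ?Z *v top_rows x\<close>.\<close>
    have "(transpose (matrix f) *v x) \<bullet> u
        = (bottom_rows x + bottom_rows X *v (matrix_inv ?Z *v top_rows x)) \<bullet> u" for u
      using b[of "matrix_inv ?Z *v top_rows x" u]
      by (simp add: inner_transpose_mult N f x inner_add_left matrix_vector_mul_assoc matrix_inv_mult[OF CX] del: transpose_matrix_vector)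
    then show "transpose (matrix f) *v x = bottom_rows x + bottom_rows X *v (matrix_inv ?Z *v top_rows x)"
      using vector_eq_rdot by blast
  qed
qed

subsection \<open>Householder reflections\<close>

lemma nth_index_less_iff:
  assumes "i < CARD('p)" "k < CARD('p)"
  shows "(nth_index i :: 'p::{finite,linorder}) < nth_index k \<longleftrightarrow> i < k"
proof -
  let ?xs = "sorted_list_of_set (UNIV :: 'p set)"
  have "sorted_wrt (<) ?xs" by simp
  then have "i < k \<Longrightarrow> nth_index i < (nth_index k :: 'p)" if "i < CARD('p)" "k < CARD('p)" for i k
    using that sorted_wrt_nth_less[of "(<)" ?xs i k] by (simp add: nth_index_def)
  with assms show ?thesis
    by (metis less_asym linorder_neqE_nat nless_le)
qed

lemma range_nth_index: "nth_index ` {..<CARD('p)} = (UNIV :: 'p::{finite,linorder} set)"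
proof -
  have "x \<in> nth_index ` {..<CARD('p)}" for x :: 'p
    using in_set_conv_nth[of x "sorted_list_of_set UNIV"] by (force simp: nth_index_def)
  then show ?thesis by auto
qed

lemma inj_on_nth_index: "inj_on (nth_index :: nat \<Rightarrow> 'p::{finite,linorder}) {..<CARD('p)}"
  by (rule eq_card_imp_inj_on) (simp_all add: range_nth_index)

text \<open>\<open>zero_first\<close> measures positions by \<open>card {..<j}\<close>, while the
  algorithm runs through \<open>nth_index k\<close>. This lemma and
  \<open>nth_index_card_lessThan\<close> make the two translations mutually inverse.\<close>

lemma card_lessThan_nth_index:
  assumes "k < CARD('p)"
  shows "card {..<(nth_index k :: 'p::{finite,linorder})} = k"
proof -
  have "{..<(nth_index k :: 'p)} = nth_index ` {..<k}"
  proof (intro set_eqI iffI)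
    fix x :: 'p
    obtain i where i: "x = nth_index i" "i < CARD('p)"
      using range_nth_index[where ?'p='p] by (metis UNIV_I imageE lessThan_iff)
    assume "x \<in> {..<nth_index k}"
    with i assms show "x \<in> nth_index ` {..<k}"
      by (auto simp: nth_index_less_iff)
  next
    fix x :: 'p
    assume "x \<in> nth_index ` {..<k}"
    with assms show "x \<in> {..<nth_index k}"
      by (auto simp: nth_index_less_iff)
  qed
  moreover have "inj_on (nth_index :: nat \<Rightarrow> 'p) {..<k}"
    using assms by (intro inj_on_subset[OF inj_on_nth_index]) auto
  ultimately show ?thesis by (simp add: card_image)
qed

lemma card_lessThan_less: "card {..<(j :: 'p::{finite,linorder})} < CARD('p)"
  by (intro psubset_card_mono) auto

lemma nth_index_card_lessThan: "nth_index (card {..<j}) = (j :: 'p::{finite,linorder})"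
proof -
  obtain i where "j = nth_index i" "i < CARD('p)"
    using range_nth_index[where ?'p='p] by (metis UNIV_I imageE lessThan_iff)
  then show ?thesis by (simp add: card_lessThan_nth_index)
qed

section \<open>Truncation and a single Householder step\<close>

lemma zero_first_nth [simp]:
  "zero_first k x $ Inl j = (if card {..<j} < k then 0 else x $ Inl j)"
  "zero_first k x $ Inr i = x $ Inr i"
  by (simp_all add: zero_first_def)

lemma vec_sum_eqI:
  fixes x y :: "'a^('p::finite + 'q::finite)"
  assumes "\<And>j. x $ Inl j = y $ Inl j" "\<And>i. x $ Inr i = y $ Inr i"
  shows "x = y"
  using assms by (metis sum.exhaust_sel vec_eq_iff)

lemma linear_zero_first: "linear (zero_first k)"
  by (intro linearI vec_sum_eqI) auto

text \<open>A coordinate projection is self-adjoint. This is how truncation is moved from a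
  Householder vector to the vector it is paired with.\<close>

lemma zero_first_inner: "zero_first k x \<bullet> y = x \<bullet> zero_first k y"
  unfolding inner_vec_def
proof (rule sum.cong)
  show "zero_first k x $ i \<bullet> y $ i = x $ i \<bullet> zero_first k y $ i" for i
    by (cases i) auto
qed simp

text \<open>The added axis vector sits at position \<open>k\<close> counted from 0, the first
  position that \<open>zero_first k\<close> leaves alone.\<close>

lemma zero_first_householder_vector:
  assumes "k < CARD('p)"
  shows "zero_first k (householder_vector k s x) = householder_vector k s (x :: real^('p::{finite,linorder} + 'q::finite))"
  by (rule vec_sum_eqI) (auto simp: householder_vector_def axis_def card_lessThan_nth_index assms)

lemma householder_vector_pivot:
  fixes x :: "real^('p::{finite,linorder} + 'q::finite)"
  assumes "k < CARD('p)"
  shows "householder_vector k s x $ Inl (nth_index k) = x $ Inl (nth_index k) + s * norm (zero_first k x)"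
  by (simp add: householder_vector_def axis_def card_lessThan_nth_index assms)

text \<open>For \<open>v = 0\<close> the coefficient is a division by zero, and the formula still gives the identity.\<close>

lemma householder_reflection_mult:
  "householder_reflection v *v x = x - (2 * (v \<bullet> x) / (norm v)\<^sup>2) *\<^sub>R v"
proof -
  have "(\<chi> i j. v $ i * v $ j) *v x = (v \<bullet> x) *\<^sub>R v"
    by (simp add: vec_eq_iff matrix_vector_mult_def inner_vec_def sum_distrib_left mult_ac)
  then show ?thesis
    by (simp add: householder_reflection_def matrix_vector_mult_diff_rdistrib flip: scaleR_matrix_vector_assoc)
qed

lemma norm_householder_reflection: "norm (householder_reflection v *v x) = norm x"
proof (cases "v = 0")
  case False
  define c where "c = 2 * (v \<bullet> x) / (norm v)\<^sup>2"
  have c: "c * (v \<bullet> v) = 2 * (v \<bullet> x)"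
    using False by (simp add: c_def power2_norm_eq_inner)
  have "(x - c *\<^sub>R v) \<bullet> (x - c *\<^sub>R v) = x \<bullet> x - 2 * c * (v \<bullet> x) + c * (c * (v \<bullet> v))"
    by (simp add: inner_diff_left inner_diff_right inner_commute[of x v] algebra_simps)
  also have "\<dots> = x \<bullet> x"
    by (simp add: c)
  finally show ?thesis
    by (simp add: householder_reflection_mult norm_eq_sqrt_inner c_def)
qed (simp add: householder_reflection_def)

text \<open>If \<open>v\<close> is nonzero, then \<open>v \<bullet> v = 2 * (v \<bullet> x)\<close>,
  so the reflection sends \<open>x\<close> to \<open>x - v\<close>. This is \<open>x - z\<close>
  minus a multiple of \<open>e\<close>, and both are supported on the first \<open>k + 1\<close>
  positions.\<close>

lemma zero_first_Suc_householder_reflection: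
  fixes x :: "real^('p::{finite,linorder} + 'q::finite)"
  assumes k: "k < CARD('p)" and s: "s \<in> {1, -1}"
  shows "zero_first (Suc k) (householder_reflection (householder_vector k s x) *v x) = 0"
proof -
  define z where "z = zero_first k x"
  define e :: "real^('p + 'q)" where "e = axis (Inl (nth_index k)) 1"
  define v where "v = householder_vector k s x"
  have v: "v = z + (s * norm z) *\<^sub>R e"
    by (simp add: v_def z_def e_def householder_vector_def)
  have e: "zero_first (Suc k) e = 0"
    by (rule vec_sum_eqI) (auto simp: e_def axis_def card_lessThan_nth_index k)
  have xz: "zero_first (Suc k) (x - z) = 0"
    by (rule vec_sum_eqI) (auto simp: z_def)
  show ?thesis
  proof (cases "v = 0")
    \<comment> \<open>As \<open>s\<close> is an arbitrary sign here, \<open>v = 0\<close> can occur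
      with \<open>z\<close> nonzero; but then \<open>z\<close> is a multiple of \<open>e\<close>,
      and the identity suffices.\<close>
    case True
    then have "z = (- s * norm z) *\<^sub>R e"
      using v by (simp add: add_eq_0_iff2)
    then have "zero_first (Suc k) z = zero_first (Suc k) ((- s * norm z) *\<^sub>R e)"
      by (rule arg_cong)
    also have "\<dots> = 0"
      by (simp only: linear_scale[OF linear_zero_first] e scaleR_zero_right)
    finally have "zero_first (Suc k) z = 0" .
    then have "zero_first (Suc k) x = 0"
      using xz by (simp add: linear_diff[OF linear_zero_first])
    with True show ?thesis
      by (simp add: householder_reflection_def flip: v_def)
  next
    case False
    have ez: "e \<bullet> x = e \<bullet> z"
      by (simp add: e_def z_def inner_axis' card_lessThan_nth_index k)
    have zx: "z \<bullet> x = z \<bullet> z"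
    proof -
      have "zero_first k z = z" by (rule vec_sum_eqI) (auto simp: z_def)
      then show ?thesis by (metis z_def zero_first_inner)
    qed
    have "v \<bullet> x = z \<bullet> z + s * norm z * (e \<bullet> z)"
      by (simp add: v inner_add_left ez zx)
    moreover have "v \<bullet> v = 2 * (z \<bullet> z + s * norm z * (e \<bullet> z))"
    proof -
      \<comment> \<open>Here the assumption that \<open>s\<close> is a sign enters: the added
        multiple of \<open>e\<close> has the same norm as \<open>z\<close>.\<close>
      have "s * s = 1" "e \<bullet> e = 1"
        using s by (auto simp: e_def inner_axis_axis)
      then have "(s * norm z) * (s * norm z) * (e \<bullet> e) = z \<bullet> z"
        by (simp add: power_mult_distrib flip: power2_norm_eq_inner power2_eq_square)
      then show ?thesis
        by (simp add: v inner_add_left inner_add_right inner_commute[of z e] algebra_simps)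
    qed
    ultimately have vx: "2 * (v \<bullet> x) = v \<bullet> v"
      by simp
    have "householder_reflection v *v x = x - v"
      unfolding householder_reflection_mult vx using False by (simp add: power2_norm_eq_inner)
    also have "\<dots> = (x - z) - (s * norm z) *\<^sub>R e"
      by (simp add: v)
    finally have "zero_first (Suc k) (householder_reflection v *v x)
        = zero_first (Suc k) (x - z) - (s * norm z) *\<^sub>R zero_first (Suc k) e"
      by (simp only: linear_diff[OF linear_zero_first] linear_scale[OF linear_zero_first])
    then show ?thesis
      by (simp add: e xz flip: v_def)
  qed
qed

text \<open>The Householder vector vanishes before position \<open>k\<close> and \<open>u\<close>
  from position \<open>k\<close> on, so they are orthogonal.\<close>

lemma householder_reflection_fixes:
  assumes "zero_first k u = 0" and "k < CARD('p)"
  shows "householder_reflection (householder_vector k s x) *v u = (u :: real^('p::{finite,linorder} + 'q::finite))"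
proof -
  have "householder_vector k s x \<bullet> u = householder_vector k s x \<bullet> zero_first k u"
    by (metis assms(2) zero_first_householder_vector zero_first_inner)
  then show ?thesis
    using assms(1) by (simp add: householder_reflection_mult)
qed

section \<open>Products of Householder reflections\<close>

lemma norm_householder_G: "norm (householder_G X d k *v x) = norm x"
  by (induction k) (simp_all add: norm_householder_reflection flip: matrix_vector_mul_assoc)

lemma zero_first_eq_0_Suc:
  assumes "zero_first k x = 0"
  shows "zero_first (Suc k) x = 0"
proof (rule vec_sum_eqI)
  show "zero_first (Suc k) x $ Inl j = 0 $ Inl j" for j
    using arg_cong[OF assms, of "\<lambda>y. y $ Inl j"] by (auto split: if_splits)
  show "zero_first (Suc k) x $ Inr i = 0 $ Inr i" for i
    using arg_cong[OF assms, of "\<lambda>y. y $ Inr i"] by simp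
qed

text \<open>Each step clears its own column below the pivot, and the later reflections fix the
  columns that are already cleared.\<close>

lemma zero_first_householder_G_column:
  fixes X :: "real^'p::{finite,linorder}^('p + 'q::finite)"
  assumes d: "\<And>k. k < CARD('p) \<Longrightarrow> d k \<in> {1, -1}" and "k \<le> CARD('p)" "j < k"
  shows "zero_first k (householder_G X d k *v column (nth_index j) X) = 0"
  using assms(2,3)
proof (induction k)
  case (Suc k)
  show ?case
  proof (cases "j = k")
    case True
    then show ?thesis
      using zero_first_Suc_householder_reflection[of k "d k" "householder_G X d k *v column (nth_index k) X"] d Suc.prems
      by (simp flip: matrix_vector_mul_assoc)
  next
    case False
    then have "zero_first k (householder_G X d k *v column (nth_index j) X) = 0"
      using Suc by simp
    then show ?thesis
      using Suc.prems by (simp add: householder_reflection_fixes zero_first_eq_0_Suc flip: matrix_vector_mul_assoc)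
  qed
qed simp

text \<open>The pivot is \<open>c + s * n\<close> with \<open>n\<close> a norm, and the standard
  sign excludes cancellation once \<open>n > 0\<close>. If \<open>n\<close> were 0, the images of
  the first \<open>k + 1\<close> columns of \<open>X\<close>, independent by full rank, would lie in
  a space of dimension \<open>k\<close>.\<close>

lemma householder_pivot_nonzero:
  fixes X :: "real^'p::{finite,linorder}^('p + 'q::finite)"
  assumes X: "rank X = CARD('p)" and signs: "standard_signs X d" and k: "k < CARD('p)"
  shows "householder_vector k (d k) (householder_G X d k *v column (nth_index k) X) $ Inl (nth_index k) \<noteq> 0"
proof -
  let ?x = "householder_G X d k *v column (nth_index k) X"
  have d: "d k \<in> {1, -1}" if "k < CARD('p)" for k
    using signs that by (simp add: standard_signs_def)
  define L where "L = (\<lambda>x. householder_G X d k *v (X *v x))"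
  have "zero_first k ?x \<noteq> 0"
  proof
    assume 0: "zero_first k ?x = 0"
    \<comment> \<open>\<open>A\<close> holds the first \<open>k + 1\<close> basis vectors, which
      \<open>L\<close> maps to transformed columns of \<open>X\<close>; \<open>V\<close> consists of
      the vectors supported on the first \<open>k\<close> positions.\<close>
    define A :: "(real^'p::_) set" where "A = (\<lambda>j. axis (nth_index j) 1) ` {..k}"
    define V :: "(real^('p::_ + 'q)) set" where "V = {x. \<forall>i. i \<notin> Inl ` nth_index ` {..<k} \<longrightarrow> x $ i = 0}"
    have "linear L"
      unfolding L_def by (simp add: matrix_vector_mul_assoc)
    moreover have "inj L"
    proof (rule injI)
      fix x y assume "L x = L y"
      then have "norm (X *v (x - y)) = 0"
        by (metis L_def matrix_vector_mult_diff_distrib norm_householder_G norm_zero right_minus_eq)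
      then show "x = y"
        using X full_rank_injective[of X] by (simp add: matrix_vector_mult_diff_distrib inj_eq)
    qed
    ultimately have "dim (L ` A) = dim A"
      by (intro dim_image_eq) (auto intro: inj_on_subset)
    moreover have "dim A = Suc k"
    proof -
      have "A \<subseteq> Basis" by (auto simp: A_def Basis_vec_def)
      then have "independent A"
        using independent_Basis independent_mono by blast
      moreover have "inj_on (\<lambda>j. axis (nth_index j :: 'p) (1::real)) {..k}"
        using k by (auto simp: inj_on_def axis_eq_axis intro: inj_onD[OF inj_on_nth_index])
      ultimately show ?thesis
        by (simp add: dim_eq_card_independent A_def card_image)
    qed
    moreover have "L ` A \<subseteq> V"
    proof
      fix y assume "y \<in> L ` A"
      then obtain j where "j \<le> k" and y: "y = householder_G X d k *v column (nth_index j) X"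
        by (auto simp: A_def L_def matrix_vector_mult_basis)
      then have z: "zero_first k y = 0"
        using 0 zero_first_householder_G_column[of d k j X] d k by (cases "j = k") auto
      have "y $ i = 0" if "i \<notin> Inl ` nth_index ` {..<k}" for i
      proof (cases i)
        case (Inl a)
        with that have "\<not> card {..<a} < k"
          by (metis imageI lessThan_iff nth_index_card_lessThan)
        with Inl show ?thesis
          using arg_cong[OF z, of "\<lambda>y. y $ i"] by simp
      next
        case (Inr b)
        then show ?thesis
          using arg_cong[OF z, of "\<lambda>y. y $ i"] by simp
      qed
      then show "y \<in> V" by (simp add: V_def)
    qed
    moreover have "dim V \<le> k"
    proof -
      have "card (nth_index ` {..<k} :: 'p set) \<le> k"
        using card_image_le[of "{..<k}" "nth_index :: nat \<Rightarrow> 'p"] by simp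
      then show ?thesis
        using dim_substandard_cart[of "Inl ` nth_index ` {..<k} :: ('p + 'q) set", where ?'a=real]
        by (simp add: V_def card_image dim_vec_eq)
    qed
    ultimately show False
      using dim_subset[of "L ` A" V] by simp
  qed
  then have "norm (zero_first k ?x) > 0" by simp
  moreover have "c + s * n \<noteq> 0" if "n > 0" "s \<in> {1, -1}" "c \<noteq> 0 \<Longrightarrow> s = sgn c" for c s n :: real
    using that by (cases c "0::real" rule: linorder_cases) auto
  moreover have "?x $ Inl (nth_index k) \<noteq> 0 \<Longrightarrow> d k = sgn (?x $ Inl (nth_index k))"
    using signs k by (auto simp: standard_signs_def Let_def)
  ultimately show ?thesis
    using k d[OF k] by (simp only: householder_vector_pivot not_False_eq_True)
qed

text \<open>Step \<open>m\<close> subtracts a multiple of a vector whose first \<open>m\<close>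
  entries vanish, so the first \<open>k\<close> entries are final after \<open>k\<close>
  steps.\<close>

lemma householder_G_first_entries:
  fixes X :: "real^'p::{finite,linorder}^('p + 'q::finite)"
  assumes "k \<le> m" "m \<le> CARD('p)" "card {..<j} < k"
  shows "(householder_G X d m *v y) $ Inl j = (householder_G X d k *v y) $ Inl j"
  using assms(1,2)
proof (induction m rule: dec_induct)
  case (step m)
  let ?v = "householder_vector m (d m) (householder_G X d m *v column (nth_index m) X)"
  have "zero_first m ?v $ Inl j = 0"
    using step(1) assms(3) by simp
  then have "?v $ Inl j = 0"
    using step.prems by (simp add: zero_first_householder_vector)
  then show ?case
    using step by (simp add: householder_reflection_mult flip: matrix_vector_mul_assoc)
qed simp

text \<open>A forward pass shows that every step fixes \<open>y\<close>, hence that \<open>y\<close>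
  is orthogonal to every \<open>v k\<close>. A backward pass then removes the entries of
  \<open>y\<close> one by one, starting from the last of the first block.\<close>

lemma householder_fixed_vector:
  fixes X :: "real^'p::{finite,linorder}^('p + 'q::finite)"
  assumes X: "rank X = CARD('p)" and signs: "standard_signs X d"
    and fixed: "householder_G X d CARD('p) *v y = y" and y: "bottom_rows y = 0"
  shows "y = 0"
proof -
  define v where "v k = householder_vector k (d k) (householder_G X d k *v column (nth_index k) X)" for k
  have pivot: "v k $ Inl (nth_index k) \<noteq> 0" if "k < CARD('p)" for k
    using householder_pivot_nonzero[OF X signs that] by (simp add: v_def)
  have step: "v k \<bullet> y = 0 \<and> householder_G X d (Suc k) *v y = y"
    if k: "k < CARD('p)" and G: "householder_G X d k *v y = y" for k
  proof -
    let ?c = "2 * (v k \<bullet> y) / (norm (v k))\<^sup>2"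
    have S: "householder_G X d (Suc k) *v y = y - ?c *\<^sub>R v k"
      by (simp add: householder_reflection_mult G v_def flip: matrix_vector_mul_assoc)
    \<comment> \<open>This entry is final after step \<open>k\<close>, so it already has its value
      in the full product, which fixes \<open>y\<close>.\<close>
    have "y $ Inl (nth_index k) = (householder_G X d (Suc k) *v y) $ Inl (nth_index k)"
      using householder_G_first_entries[of "Suc k" "CARD('p)" "nth_index k :: 'p" X d y] k
      by (simp add: fixed card_lessThan_nth_index del: householder_G.simps)
    then have "?c * v k $ Inl (nth_index k) = 0"
      unfolding S by simp
    \<comment> \<open>The nonzero pivot also ensures that \<open>v k\<close> is nonzero, so the
      coefficient does not vanish through division by zero.\<close>
    then have "v k \<bullet> y = 0"
      using pivot[OF k] by auto
    with S show ?thesis by simp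
  qed
  have "householder_G X d k *v y = y" if "k \<le> CARD('p)" for k
    using that by (induction k) (use step in \<open>auto simp del: householder_G.simps(2)\<close>)
  then have vy: "v k \<bullet> y = 0" if "k < CARD('p)" for k
    using step that by simp
  \<comment> \<open>The induction on \<open>m\<close> lets the start of the vanishing tail of
    \<open>y\<close> descend from \<open>CARD('p)\<close> to 0; the base case is
    \<open>bottom_rows y = 0\<close>.\<close>
  have "zero_first (CARD('p) - m) y = 0" if "m \<le> CARD('p)" for m
    using that
  proof (induction m)
    case 0
    show ?case
      using y by (intro vec_sum_eqI) (simp_all add: card_lessThan_less bottom_rows_def vec_eq_iff)
  next
    case (Suc m)
    define k where "k = CARD('p) - Suc m"
    have k: "k < CARD('p)" "CARD('p) - m = Suc k"
      using Suc.prems by (auto simp: k_def)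
    have "zero_first (Suc k) y = 0"
      using Suc k by simp
    then have 0: "y $ Inl j = 0" if "\<not> card {..<j} \<le> k" for j
      using that by (metis not_less_eq_eq zero_first_nth(1) zero_index less_Suc_eq_le)
    have 1: "y $ Inr i = 0" for i
      using \<open>zero_first (Suc k) y = 0\<close> by (metis zero_first_nth(2) zero_index)
    have ax: "zero_first k y = axis (Inl (nth_index k)) (y $ Inl (nth_index k))"
    proof (rule vec_sum_eqI)
      fix j :: 'p
      show "zero_first k y $ Inl j = axis (Inl (nth_index k)) (y $ Inl (nth_index k)) $ Inl j"
      proof (cases "j = nth_index k")
        case True
        with k(1) show ?thesis by (simp add: axis_def card_lessThan_nth_index)
      next
        case False
        then have "card {..<j} \<noteq> k"
          using nth_index_card_lessThan[of j] by metis
        with False show ?thesis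
          using 0[of j] by (auto simp: axis_def)
      qed
    qed (simp add: axis_def 1)
    \<comment> \<open>Since \<open>v k\<close> starts at position \<open>k\<close> and
      \<open>y\<close> ends there, their inner product is the single product of the pivot with the
      entry of \<open>y\<close>.\<close>
    have "0 = v k \<bullet> zero_first k y"
      using vy[OF k(1)] zero_first_householder_vector[OF k(1)] by (metis v_def zero_first_inner)
    then have "y $ Inl (nth_index k) = 0"
      using pivot[OF k(1)] by (simp add: ax inner_axis)
    then show ?case
      using ax by (simp add: k_def axis_def vec_eq_iff)
  qed
  from this[of "CARD('p)"] have "zero_first 0 y = 0" by simp
  moreover have "zero_first 0 y = y" by (rule vec_sum_eqI) simp_all
  ultimately show ?thesis by simp
qed

section \<open>The triangular factor and its difference from the top block\<close>

lemma householder_G_mult_X: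
  fixes X :: "real^'p::{finite,linorder}^('p + 'q::finite)"
  assumes "standard_signs X d"
  shows "top_rows (householder_G X d CARD('p) *v (X *v z)) = householder_T X d *v z"
    and "bottom_rows (householder_G X d CARD('p) *v (X *v z)) = 0"
proof -
  let ?G = "householder_G X d CARD('p)"
  show "top_rows (?G *v (X *v z)) = householder_T X d *v z"
    unfolding matrix_vector_mul_assoc householder_T_def
    by (simp add: top_rows_def matrix_vector_mult_def vec_eq_iff)
  have col: "(?G *v column j X) $ Inr i = 0" for i j
    using zero_first_householder_G_column[of d "CARD('p)" "card {..<j}" X] card_lessThan_less[of j] assms
    by (metis le_refl nth_index_card_lessThan standard_signs_def zero_first_nth(2) zero_index)
  have "X *v z = (\<Sum>j\<in>UNIV. (z $ j) *\<^sub>R column j X)"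
    by (simp add: matrix_mult_sum scalar_mult_eq_scaleR)
  then have "?G *v (X *v z) = (\<Sum>j\<in>UNIV. (z $ j) *\<^sub>R (?G *v column j X))"
    by (simp add: linear_sum[OF matrix_vector_mul_linear] matrix_vector_mult_scaleR)
  then show "bottom_rows (?G *v (X *v z)) = 0"
    by (simp add: bottom_rows_def vec_eq_iff col)
qed

text \<open>The product of the reflections is an isometry that takes \<open>X *v z\<close> to
  \<open>T *v z\<close> followed by zeros, so \<open>X *v z\<close> and \<open>T *v z\<close> have
  equal norms. The first two claims follow from this and full rank, the third from
  \<open>householder_fixed_vector\<close>.\<close>

lemma householder_T_properties:
  fixes X :: "real^'p::{finite,linorder}^('p + 'q::finite)"
  assumes X: "rank X = CARD('p)" and signs: "standard_signs X d"
  shows "invertible (householder_T X d)"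
    and "orthonormal_columns (X ** matrix_inv (householder_T X d))"
    and "invertible (householder_T X d - top_rows X)"
proof -
  let ?T = "householder_T X d" and ?G = "householder_G X d CARD('p)"
  have inj: "z = 0" if "X *v z = 0" for z
    using that X matrix_nonfull_linear_equations_eq[of X] by blast
  have norm: "norm (X *v z) = norm (?T *v z)" for z
  proof -
    have "norm (?G *v (X *v z)) = norm (?T *v z)"
      by (simp add: norm_eq_sqrt_inner inner_sum_rows householder_G_mult_X[OF signs])
    then show ?thesis
      by (simp add: norm_householder_G)
  qed
  have "z = 0" if "?T *v z = 0" for z
    using that norm[of z] inj by simp
  then show T: "invertible ?T"
    by (metis invertible_left_inverse matrix_left_invertible_ker)
  show "orthonormal_columns (X ** matrix_inv ?T)"
  proof (rule orthonormal_columnsI)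
    show "norm ((X ** matrix_inv ?T) *v u) = norm u" for u
      using norm[of "matrix_inv ?T *v u"] by (simp add: matrix_vector_mul_assoc matrix_inv_mult[OF T])
  qed
  have "z = 0" if "(?T - top_rows X) *v z = 0" for z
  proof -
    let ?y = "X *v z"
    have top: "top_rows ?y = ?T *v z"
      using that by (simp add: rows_mult matrix_vector_mult_diff_rdistrib)
    \<comment> \<open>The top block of \<open>?y\<close> equals \<open>?T *v z\<close> and so
      carries the whole norm of \<open>?y\<close>; hence the bottom block is zero, and
      \<open>?G\<close> fixes \<open>?y\<close>.\<close>
    have "?y \<bullet> ?y = top_rows ?y \<bullet> top_rows ?y"
      using norm[of z] by (simp add: top norm_eq_sqrt_inner)
    then have bottom: "bottom_rows ?y = 0"
      using inner_sum_rows[of ?y ?y] by simp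
    have "?G *v ?y = ?y"
    proof (rule vec_sum_eqI)
      show "(?G *v ?y) $ Inl j = ?y $ Inl j" for j
        using arg_cong[OF trans[OF householder_G_mult_X(1)[OF signs, of z] top[symmetric]], of "\<lambda>x. x $ j"]
        by (simp add: top_rows_def)
      show "(?G *v ?y) $ Inr i = ?y $ Inr i" for i
        using arg_cong[OF trans[OF householder_G_mult_X(2)[OF signs, of z] bottom[symmetric]], of "\<lambda>x. x $ i"]
        by (simp add: bottom_rows_def)
    qed
    then have "?y = 0"
      using X signs bottom by (intro householder_fixed_vector)
    then show "z = 0" by (rule inj)
  qed
  then show "invertible (?T - top_rows X)"
    by (metis invertible_left_inverse matrix_left_invertible_ker)
qed

section \<open>Reduction of the three cases to one orthonormal complement\<close>

theorem theorem3:
  fixes X :: "real^'p::{finite,linorder}^('p + 'q::finite)"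
    and \<beta> :: "real^'p::{finite,linorder}"
    and \<sigma> :: real
    and M :: "'a measure"
    and Y :: "'a \<Rightarrow> real^('p + 'q)"
    and R :: "'a \<Rightarrow> real^('p + 'q)"
    and v :: "'a \<Rightarrow> real^'p::{finite,linorder}"
    and W :: "'a \<Rightarrow> real^'q"
  assumes "rank X = CARD('p)"
    and "\<sigma>\<^sup>2 > 0"
    and "prob_space M"
    and "distributed M lborel (\<lambda>\<omega>. Y \<omega> - X *v \<beta>) (mvn_density 0 (\<sigma>\<^sup>2 *\<^sub>R mat 1))"
    and R: "\<And>\<omega>. \<omega> \<in> space M \<Longrightarrow> R \<omega> = residual X (Y \<omega>)"
    and v: "(\<exists>d. standard_signs X d \<and>
               (\<forall>\<omega>\<in>space M.
                  v \<omega> = matrix_inv (householder_T X d - top_rows X) *v top_rows (R \<omega>)))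
          \<or> (\<exists>C. invertible C \<and> orthonormal_columns (X ** matrix_inv C) \<and>
               invertible (C - top_rows X) \<and>
               (\<forall>\<omega>\<in>space M. v \<omega> = matrix_inv (C - top_rows X) *v top_rows (R \<omega>)))
          \<or> (\<exists>C S.
               invertible C \<and> orthonormal_columns (X ** matrix_inv C) \<and>
               rank S = rank (C - top_rows X) \<and>
               (\<exists>N.
                  orthonormal_columns N \<and> col_space N = orthogonal_comp (col_space X) \<and>
                  (\<forall>x\<in>orthogonal_comp (col_space X).
                     transpose N *v x = bottom_rows x + bottom_rows X *v (S *v top_rows x))) \<and>
               (\<forall>\<omega>\<in>space M. v \<omega> = S *v top_rows (R \<omega>)))"
    and W: "\<And>\<omega>. \<omega> \<in> space M \<Longrightarrow> W \<omega> = bottom_rows (R \<omega>) + bottom_rows X *v v \<omega>"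
  shows "distributed M lborel W (mvn_density 0 (\<sigma>\<^sup>2 *\<^sub>R mat 1))
    \<and> (\<forall>\<omega>\<in>space M. W \<omega> \<bullet> W \<omega> = R \<omega> \<bullet> R \<omega>)"
proof -
  have "\<sigma> \<noteq> 0"
    using \<open>\<sigma>\<^sup>2 > 0\<close> by auto
  \<comment> \<open>The common form of the cases; \<open>D\<close> is the inverse of
    \<open>C\<close>, or of \<open>T\<close> in case (i).\<close>
  have "\<exists>D :: real^'p::{finite,linorder}^'p::{finite,linorder}. \<exists>N. orthonormal_columns (X ** D)
      \<and> orthonormal_columns N \<and> col_space N = orthogonal_comp (col_space X)
      \<and> (\<forall>\<omega>\<in>space M. W \<omega> = transpose N *v R \<omega>)"
  proof -
    have RX: "R \<omega> \<in> orthogonal_comp (col_space X)" if "\<omega> \<in> space M" for \<omega>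
      using that residual_orthogonal_comp[OF \<open>rank X = CARD('p)\<close>] by (simp add: R)
    \<comment> \<open>Case (ii) in a form that case (i) reuses with the Householder factor in place
      of \<open>C\<close>.\<close>
    have from_C: ?thesis
      if C: "invertible C" "orthonormal_columns (X ** matrix_inv C)" "invertible (C - top_rows X)"
        and vC: "\<forall>\<omega>\<in>space M. v \<omega> = matrix_inv (C - top_rows X) *v top_rows (R \<omega>)" for C
    proof -
      obtain N :: "real^'q^('p + 'q)" where N: "orthonormal_columns N"
        "col_space N = orthogonal_comp (col_space X)"
        "\<And>x. x \<in> orthogonal_comp (col_space X) \<Longrightarrow>
          transpose N *v x = bottom_rows x + bottom_rows X *v (matrix_inv (C - top_rows X) *v top_rows x)"
        using orthonormal_complement_exists[OF \<open>rank X = CARD('p)\<close> C] by blast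
      have "W \<omega> = transpose N *v R \<omega>" if "\<omega> \<in> space M" for \<omega>
        using that by (simp add: W vC N(3)[OF RX] del: transpose_matrix_vector)
      then show ?thesis
        using C(2) N(1,2) by blast
    qed
    from v show ?thesis
    proof (elim disjE exE conjE)
      fix d
      assume "standard_signs X d"
        and "\<forall>\<omega>\<in>space M. v \<omega> = matrix_inv (householder_T X d - top_rows X) *v top_rows (R \<omega>)"
      then show ?thesis
        using householder_T_properties[OF \<open>rank X = CARD('p)\<close>] by (intro from_C)
    next
      fix C
      assume "invertible C" "orthonormal_columns (X ** matrix_inv C)" "invertible (C - top_rows X)"
        and "\<forall>\<omega>\<in>space M. v \<omega> = matrix_inv (C - top_rows X) *v top_rows (R \<omega>)"
      then show ?thesis by (rule from_C)
    next
      fix C S :: "real^'p::{finite,linorder}^'p::{finite,linorder}" and N :: "real^'q^('p + 'q)"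
      assume C: "orthonormal_columns (X ** matrix_inv C)"
        and N: "orthonormal_columns N" "col_space N = orthogonal_comp (col_space X)"
          "\<forall>x\<in>orthogonal_comp (col_space X).
            transpose N *v x = bottom_rows x + bottom_rows X *v (S *v top_rows x)"
        and vS: "\<forall>\<omega>\<in>space M. v \<omega> = S *v top_rows (R \<omega>)"
      \<comment> \<open>In case (iii) the hypothesis supplies \<open>N\<close>, and its identity is
        applied to the residual, which lies in the orthogonal complement.\<close>
      have "W \<omega> = transpose N *v R \<omega>" if "\<omega> \<in> space M" for \<omega>
        using that by (simp add: W vS N(3)[rule_format, OF RX] del: transpose_matrix_vector)
      then show ?thesis
        using C N(1,2) by blast
    qed
  qed
  then obtain D :: "real^'p::{finite,linorder}^'p::{finite,linorder}" and N where "orthonormal_columns (X ** D)"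
    "orthonormal_columns N" "col_space N = orthogonal_comp (col_space X)"
    "\<forall>\<omega>\<in>space M. W \<omega> = transpose N *v R \<omega>"
    by blast
  then have "distributed M lborel W (mvn_density 0 (\<sigma>\<^sup>2 *\<^sub>R mat 1))
      \<and> (\<forall>\<omega>\<in>space M. W \<omega> \<bullet> W \<omega> = residual X (Y \<omega>) \<bullet> residual X (Y \<omega>))"
    using \<open>rank X = CARD('p)\<close> \<open>\<sigma> \<noteq> 0\<close> assms(4) R by (intro transformed_residuals) simp_all
  then show ?thesis
    by (simp add: R)
qed

end
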